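(* Both the fully discrete first-order scheme and the fully discrete second-order scheme described in the context are locally mass-conservative with respect to the wetting phase $S_w$ and the non-wetting phase $S_n$.
   Context: Setting: two decoupled schemes for incompressible immiscible two-phase flow in porous media ($\alpha=w$ wetting, $\alpha=n$ non-wetting; $S_\alpha$ saturations, $p$ pressure, $\mu_\alpha$ chemical potentials), with zero injection/production rates and no-flow boundary conditions. Grid: a rectangular domain $\Omega$ is divided uniformly into square (cubic in three dimensions) cells of side $h$. $\mathcal C_h$ is the space of real functions on the cell centers and $\mathcal C_h^0$ its subspace of functions with zero mean. $\nabla_h c$ is the face-centered difference quotient $(c^+-c^-)/h$ of the values at the two cell centers adjacent to a face; $\nabla_h\cdot$ is the cell-centered divergence, the sum over coordinate directions of (upper face value minus lower face value)$/h$; fluxes vanish on boundary faces. Parameters: $\Delta t,m,K,\eta_w,\eta_n,\sigma_w,\sigma_n,\sigma_{wn}>0$ are constants; the porosity $\phi_h\in\mathcal C_h$ is time-independent with $0<\phi_h<1$. For a face-centered mobility $M$, $\mathcal L_M=(-\nabla_h\cdot M\nabla_h)/\phi_h$, with inverse $\mathcal L_M^{-1}$ taken in the mean-zero sense (values in $\mathcal C_h^0$). First-order scheme. $\check M_{\alpha,1}$ on a face is the arithmetic mean of $K(S_{\alpha,h}^k)^m/\eta_\alpha$ over the two adjacent cell centers. Step 1: find $S_{w,h}^{k+1}$ with $\mu_{w,h}^{k+1}-\mu_{n,h}^{k+1}+\frac1{\Delta t}\mathcal L^{-1}_{\check M_{w,1}}(S_{w,h}^{k+1}-S_{w,h}^k)+\frac1{\Delta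 t}\mathcal L^{-1}_{\check M_{n,1}}(S_{w,h}^{k+1}-S_{w,h}^k)=0$, where $\mu_{w,h}^{k+1}=\sigma_w\ln(S_{w,h}^{k+1})+\sigma_{wn}S_{n,h}^k$ and $\mu_{n,h}^{k+1}=\sigma_n\ln(1-S_{w,h}^{k+1})+\sigma_{wn}S_{w,h}^k$. Step 2: $p_h^{k+1}+\mu_{w,h}^{k+1}+\frac1{\Delta t}\mathcal L^{-1}_{\check M_{w,1}}(S_{w,h}^{k+1}-S_{w,h}^k)=0$ and $S_{n,h}^{k+1}=1-S_{w,h}^{k+1}$. Second-order scheme. $S_{\alpha,h}^{k+\frac12}=\frac12(S_{\alpha,h}^{k+1}+S_{\alpha,h}^k)$, $\tilde S_{\alpha,h}^{k+1}=\frac32S_{\alpha,h}^k-\frac12S_{\alpha,h}^{k-1}$, and $\check M_{\alpha,2}$ on a face is the arithmetic mean of $K(\tilde S_{\alpha,h}^{k+1})^m/\eta_\alpha$ over the two adjacent cell centers. $\mathcal H(x,a)=\frac{x\ln x-a\ln a}{x-a}$ for $x\ne a$, with $\mathcal H(a,a)-1$ understood as $\ln a$. Step 1: find $S_{w,h}^{k+1}$ with $\mu_{w,h}^{k+\frac12}-\mu_{n,h}^{k+\frac12}+\frac1{\Delta t}\mathcal L^{-1}_{\check M_{w,2}}(S_{w,h}^{k+1}-S_{w,h}^k)+\frac1{\Delta t}\mathcal L^{-1}_{\check M_{n,2}}(S_{w,h}^{k+1}-S_{w,h}^k)=0$, where $\mu_{w,h}^{k+\frac12}=\sigma_w(\mathcal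 H(S_{w,h}^{k+1},S_{w,h}^k)-1)+\sigma_{wn}(1-S_{w,h}^{k+\frac12})+\Delta t(\ln S_{w,h}^{k+1}-\ln S_{w,h}^k)$ and $\mu_{n,h}^{k+\frac12}=\sigma_n(\mathcal H(1-S_{w,h}^{k+1},1-S_{w,h}^k)-1)+\sigma_{wn}S_{w,h}^{k+\frac12}+\Delta t(\ln(1-S_{w,h}^{k+1})-\ln S_{n,h}^k)$. Step 2: $p_h^{k+\frac12}+\mu_{w,h}^{k+\frac12}+\frac1{\Delta t}\mathcal L^{-1}_{\check M_{w,2}}(S_{w,h}^{k+1}-S_{w,h}^k)=0$ and $S_{n,h}^{k+1}=1-S_{w,h}^{k+1}$. Local mass conservation refers to the discrete mass conservation equations of the coupled forms from which these decoupled schemes are derived as equivalent systems: for $\alpha=w,n$, $\phi_h\frac{S_{\alpha,h}^{k+1}-S_{\alpha,h}^k}{\Delta t}-\nabla_h\cdot(\check M_{\alpha,1}\nabla_h(p_h^{k+1}+\mu_{\alpha,h}^{k+1}))=0$ for the first-order scheme, and $\phi_h\frac{S_{\alpha,h}^{k+1}-S_{\alpha,h}^k}{\Delta t}-\nabla_h\cdot(\check M_{\alpha,2}\nabla_h(p_h^{k+\frac12}+\mu_{\alpha,h}^{k+\frac12}))=0$ for the second-order scheme. *)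

theory Defs
  imports Complex_Main "HOL-Library.FuncSet" "HOL-Library.Cardinality"
begin

text \<open>
  Cells are multi-indices c with c i < n i.  A face is a pair (i, c), namely the face orthogonal
  to direction i between the cells c - e_i and c; it lies on the boundary of the domain iff
  c i = 0 or c i = n i.  Values of cell and face functions off the grid are never used.
\<close>

type_synonym 'd cell_fun = "('d \<Rightarrow> nat) \<Rightarrow> real"
type_synonym 'd face_fun = "'d \<Rightarrow> ('d \<Rightarrow> nat) \<Rightarrow> real"

definition upper :: "'d \<Rightarrow> ('d \<Rightarrow> nat) \<Rightarrow> ('d \<Rightarrow> nat)" where
  "upper i c = c(i := c i + 1)"

definition lower :: "'d \<Rightarrow> ('d \<Rightarrow> nat) \<Rightarrow> ('d \<Rightarrow> nat)" where
  "lower i c = c(i := c i - 1)"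

text \<open>
  The library's powr depends only on the absolute value of a negative base.  Extrapolated
  saturations may be negative, so for natural exponents the ordinary power is used.
\<close>

definition sat_power :: "real \<Rightarrow> real \<Rightarrow> real" where
  "sat_power x m = (if m \<in> \<nat> then x ^ nat \<lfloor>m\<rfloor> else x powr m)"

text \<open>The value at x = a makes H(a,a) - 1 equal to ln a.\<close>

definition \<H> :: "real \<Rightarrow> real \<Rightarrow> real" where
  "\<H> x a = (if x = a then ln a + 1 else (x * ln x - a * ln a) / (x - a))"

locale two_phase_grid =
  fixes n :: "'d::finite \<Rightarrow> nat" and h :: real and \<phi> :: "'d cell_fun"
    and \<Delta>t m K \<eta>\<^sub>w \<eta>\<^sub>n \<sigma>\<^sub>w \<sigma>\<^sub>n \<sigma>\<^sub>w\<^sub>n :: real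
  assumes dim: "CARD('d) = 2 \<or> CARD('d) = 3"
    and n_pos: "\<And>i. n i > 0" and h_pos: "h > 0"
    and porosity: "\<And>c. (\<And>i. c i < n i) \<Longrightarrow> 0 < \<phi> c \<and> \<phi> c < 1"
    and pos: "\<Delta>t > 0" "m > 0" "K > 0" "\<eta>\<^sub>w > 0" "\<eta>\<^sub>n > 0" "\<sigma>\<^sub>w > 0" "\<sigma>\<^sub>n > 0" "\<sigma>\<^sub>w\<^sub>n > 0"
begin

definition cells :: "('d \<Rightarrow> nat) set" where
  "cells = {c. \<forall>i. c i < n i}"

definition \<C>\<^sub>0 :: "'d cell_fun set" where
  "\<C>\<^sub>0 = {u \<in> extensional cells. (\<Sum>c\<in>cells. u c) / card cells = 0}"

definition grad :: "'d cell_fun \<Rightarrow> 'd face_fun" where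
  "grad u i c = (u c - u (lower i c)) / h"

definition flux :: "'d face_fun \<Rightarrow> 'd cell_fun \<Rightarrow> 'd face_fun" where
  "flux M u i c = (if 0 < c i \<and> c i < n i then M i c * grad u i c else 0)"

definition div_h :: "'d face_fun \<Rightarrow> 'd cell_fun" where
  "div_h F c = (\<Sum>i\<in>UNIV. (F i (upper i c) - F i c) / h)"

definition \<L> :: "'d face_fun \<Rightarrow> 'd cell_fun \<Rightarrow> 'd cell_fun" where
  "\<L> M u = (\<lambda>c\<in>cells. - div_h (flux M u) c / \<phi> c)"

definition \<L>_inv :: "'d face_fun \<Rightarrow> 'd cell_fun \<Rightarrow> 'd cell_fun" where
  "\<L>_inv M = the_inv_into \<C>\<^sub>0 (\<L> M)"

text \<open>
  By the no-flow condition every value f of the operator satisfies the compatibility condition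
  that \<phi> f has zero mean.  The expression \<L>_inv M f is meaningful only for such f, and only if
  the operator is one-to-one on mean-zero functions; the latter holds whenever M is positive on
  all interior faces.  Both schemes below require these two conditions wherever they use \<L>_inv.
\<close>

definition invertible :: "'d face_fun \<Rightarrow> bool" where
  "invertible M \<longleftrightarrow> inj_on (\<L> M) \<C>\<^sub>0"

definition compatible :: "'d cell_fun \<Rightarrow> bool" where
  "compatible f \<longleftrightarrow> (\<lambda>c\<in>cells. \<phi> c * f c) \<in> \<C>\<^sub>0"

definition increment :: "(nat \<Rightarrow> 'd cell_fun) \<Rightarrow> nat \<Rightarrow> 'd cell_fun" where
  "increment S k = (\<lambda>c\<in>cells. S (k + 1) c - S k c)"

definition mobility :: "real \<Rightarrow> 'd cell_fun \<Rightarrow> 'd face_fun" where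
  "mobility \<eta> S i c =
     (K * sat_power (S (lower i c)) m / \<eta> + K * sat_power (S c) m / \<eta>) / 2"

definition conserves_mass ::
  "'d face_fun \<Rightarrow> 'd cell_fun \<Rightarrow> 'd cell_fun \<Rightarrow> 'd cell_fun \<Rightarrow> bool" where
  "conserves_mass M S_old S_new q \<longleftrightarrow>
     (\<forall>c\<in>cells. \<phi> c * ((S_new c - S_old c) / \<Delta>t) - div_h (flux M q) c = 0)"


subsection \<open>First-order scheme\<close>

definition \<mu>\<^sub>w1 :: "(nat \<Rightarrow> 'd cell_fun) \<Rightarrow> (nat \<Rightarrow> 'd cell_fun) \<Rightarrow> nat \<Rightarrow> 'd cell_fun" where
  "\<mu>\<^sub>w1 S\<^sub>w S\<^sub>n k c = \<sigma>\<^sub>w * ln (S\<^sub>w (k + 1) c) + \<sigma>\<^sub>w\<^sub>n * S\<^sub>n k c"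

definition \<mu>\<^sub>n1 :: "(nat \<Rightarrow> 'd cell_fun) \<Rightarrow> nat \<Rightarrow> 'd cell_fun" where
  "\<mu>\<^sub>n1 S\<^sub>w k c = \<sigma>\<^sub>n * ln (1 - S\<^sub>w (k + 1) c) + \<sigma>\<^sub>w\<^sub>n * S\<^sub>w k c"

definition first_order_step ::
  "(nat \<Rightarrow> 'd cell_fun) \<Rightarrow> (nat \<Rightarrow> 'd cell_fun) \<Rightarrow> (nat \<Rightarrow> 'd cell_fun) \<Rightarrow> nat \<Rightarrow> bool" where
  "first_order_step S\<^sub>w S\<^sub>n p k \<longleftrightarrow>
    (let M\<^sub>w = mobility \<eta>\<^sub>w (S\<^sub>w k); M\<^sub>n = mobility \<eta>\<^sub>n (S\<^sub>n k); \<delta> = increment S\<^sub>w k in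
      invertible M\<^sub>w \<and> invertible M\<^sub>n \<and> compatible \<delta> \<and>
      (\<forall>c\<in>cells. 0 < S\<^sub>w (k + 1) c \<and> S\<^sub>w (k + 1) c < 1) \<and>
      (\<forall>c\<in>cells. \<mu>\<^sub>w1 S\<^sub>w S\<^sub>n k c - \<mu>\<^sub>n1 S\<^sub>w k c
                    + 1 / \<Delta>t * \<L>_inv M\<^sub>w \<delta> c + 1 / \<Delta>t * \<L>_inv M\<^sub>n \<delta> c = 0) \<and>
      (\<forall>c\<in>cells. p (k + 1) c + \<mu>\<^sub>w1 S\<^sub>w S\<^sub>n k c + 1 / \<Delta>t * \<L>_inv M\<^sub>w \<delta> c = 0) \<and>
      (\<forall>c\<in>cells. S\<^sub>n (k + 1) c = 1 - S\<^sub>w (k + 1) c))"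

text \<open>The first N time steps, from initial saturations that sum to one.\<close>

definition first_order_scheme ::
  "nat \<Rightarrow> (nat \<Rightarrow> 'd cell_fun) \<Rightarrow> (nat \<Rightarrow> 'd cell_fun) \<Rightarrow> (nat \<Rightarrow> 'd cell_fun) \<Rightarrow> bool" where
  "first_order_scheme N S\<^sub>w S\<^sub>n p \<longleftrightarrow>
     (\<forall>c\<in>cells. S\<^sub>n 0 c = 1 - S\<^sub>w 0 c) \<and> (\<forall>k<N. first_order_step S\<^sub>w S\<^sub>n p k)"

definition first_order_conservative ::
  "(nat \<Rightarrow> 'd cell_fun) \<Rightarrow> (nat \<Rightarrow> 'd cell_fun) \<Rightarrow> (nat \<Rightarrow> 'd cell_fun) \<Rightarrow> nat \<Rightarrow> bool" where
  "first_order_conservative S\<^sub>w S\<^sub>n p k \<longleftrightarrow>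
     conserves_mass (mobility \<eta>\<^sub>w (S\<^sub>w k)) (S\<^sub>w k) (S\<^sub>w (k + 1))
       (\<lambda>c. p (k + 1) c + \<mu>\<^sub>w1 S\<^sub>w S\<^sub>n k c) \<and>
     conserves_mass (mobility \<eta>\<^sub>n (S\<^sub>n k)) (S\<^sub>n k) (S\<^sub>n (k + 1))
       (\<lambda>c. p (k + 1) c + \<mu>\<^sub>n1 S\<^sub>w k c)"


subsection \<open>Second-order scheme\<close>

text \<open>Here p k stands for the pressure at the half level k + 1/2.\<close>

definition half_level :: "(nat \<Rightarrow> 'd cell_fun) \<Rightarrow> nat \<Rightarrow> 'd cell_fun" where
  "half_level S k c = (S (k + 1) c + S k c) / 2"

text \<open>Used for k > 0 only.\<close>

definition extrapolated :: "(nat \<Rightarrow> 'd cell_fun) \<Rightarrow> nat \<Rightarrow> 'd cell_fun" where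
  "extrapolated S k c = 3 / 2 * S k c - 1 / 2 * S (k - 1) c"

definition \<mu>\<^sub>w2 :: "(nat \<Rightarrow> 'd cell_fun) \<Rightarrow> nat \<Rightarrow> 'd cell_fun" where
  "\<mu>\<^sub>w2 S\<^sub>w k c =
     \<sigma>\<^sub>w * (\<H> (S\<^sub>w (k + 1) c) (S\<^sub>w k c) - 1) + \<sigma>\<^sub>w\<^sub>n * (1 - half_level S\<^sub>w k c)
     + \<Delta>t * (ln (S\<^sub>w (k + 1) c) - ln (S\<^sub>w k c))"

definition \<mu>\<^sub>n2 :: "(nat \<Rightarrow> 'd cell_fun) \<Rightarrow> (nat \<Rightarrow> 'd cell_fun) \<Rightarrow> nat \<Rightarrow> 'd cell_fun" where
  "\<mu>\<^sub>n2 S\<^sub>w S\<^sub>n k c =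
     \<sigma>\<^sub>n * (\<H> (1 - S\<^sub>w (k + 1) c) (1 - S\<^sub>w k c) - 1) + \<sigma>\<^sub>w\<^sub>n * half_level S\<^sub>w k c
     + \<Delta>t * (ln (1 - S\<^sub>w (k + 1) c) - ln (S\<^sub>n k c))"

definition second_order_step ::
  "(nat \<Rightarrow> 'd cell_fun) \<Rightarrow> (nat \<Rightarrow> 'd cell_fun) \<Rightarrow> (nat \<Rightarrow> 'd cell_fun) \<Rightarrow> nat \<Rightarrow> bool" where
  "second_order_step S\<^sub>w S\<^sub>n p k \<longleftrightarrow>
    (let M\<^sub>w = mobility \<eta>\<^sub>w (extrapolated S\<^sub>w k); M\<^sub>n = mobility \<eta>\<^sub>n (extrapolated S\<^sub>n k);
         \<delta> = increment S\<^sub>w k in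
      invertible M\<^sub>w \<and> invertible M\<^sub>n \<and> compatible \<delta> \<and>
      (\<forall>c\<in>cells. 0 < S\<^sub>w (k + 1) c \<and> S\<^sub>w (k + 1) c < 1) \<and>
      (\<forall>c\<in>cells. \<mu>\<^sub>w2 S\<^sub>w k c - \<mu>\<^sub>n2 S\<^sub>w S\<^sub>n k c
                    + 1 / \<Delta>t * \<L>_inv M\<^sub>w \<delta> c + 1 / \<Delta>t * \<L>_inv M\<^sub>n \<delta> c = 0) \<and>
      (\<forall>c\<in>cells. p k c + \<mu>\<^sub>w2 S\<^sub>w k c + 1 / \<Delta>t * \<L>_inv M\<^sub>w \<delta> c = 0) \<and>
      (\<forall>c\<in>cells. S\<^sub>n (k + 1) c = 1 - S\<^sub>w (k + 1) c))"

text \<open>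
  The time steps k = 1, ..., N - 1, from starting saturations at the levels 0 and 1.  Logarithms
  of the saturations at level 1 occur in the first of these steps.
\<close>

definition second_order_scheme ::
  "nat \<Rightarrow> (nat \<Rightarrow> 'd cell_fun) \<Rightarrow> (nat \<Rightarrow> 'd cell_fun) \<Rightarrow> (nat \<Rightarrow> 'd cell_fun) \<Rightarrow> bool" where
  "second_order_scheme N S\<^sub>w S\<^sub>n p \<longleftrightarrow>
     (\<forall>c\<in>cells. S\<^sub>n 0 c = 1 - S\<^sub>w 0 c \<and> S\<^sub>n 1 c = 1 - S\<^sub>w 1 c \<and> 0 < S\<^sub>w 1 c \<and> S\<^sub>w 1 c < 1) \<and>
     (\<forall>k. 0 < k \<and> k < N \<longrightarrow> second_order_step S\<^sub>w S\<^sub>n p k)"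

definition second_order_conservative ::
  "(nat \<Rightarrow> 'd cell_fun) \<Rightarrow> (nat \<Rightarrow> 'd cell_fun) \<Rightarrow> (nat \<Rightarrow> 'd cell_fun) \<Rightarrow> nat \<Rightarrow> bool" where
  "second_order_conservative S\<^sub>w S\<^sub>n p k \<longleftrightarrow>
     conserves_mass (mobility \<eta>\<^sub>w (extrapolated S\<^sub>w k)) (S\<^sub>w k) (S\<^sub>w (k + 1))
       (\<lambda>c. p k c + \<mu>\<^sub>w2 S\<^sub>w k c) \<and>
     conserves_mass (mobility \<eta>\<^sub>n (extrapolated S\<^sub>n k)) (S\<^sub>n k) (S\<^sub>n (k + 1))
       (\<lambda>c. p k c + \<mu>\<^sub>n2 S\<^sub>w S\<^sub>n k c)"

end

end

theory Submission
  imports Defs "HOL-Library.Function_Algebras"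
begin

text \<open>
  Adding the sum of the values of u to - div (M grad u) turns injectivity on mean-zero functions
  into injectivity on all cell functions: discrete fluxes telescope, so the cell sum of the
  divergence vanishes, and the sum of u is recovered from the sum of the image.  In finite
  dimension the augmented operator is therefore onto, and a preimage of a mean-zero function has
  mean zero.  Hence the inverse operators in the schemes are true inverses on the saturation
  increment.  Step 2 says that the pressure plus the wetting chemical potential is - 1/\<Delta>t times
  the inverse operator of the wetting phase applied to this increment; subtracting step 1, the
  pressure plus the non-wetting potential is 1/\<Delta>t times the inverse operator of the non-wetting
  phase.  Applying the two operators gives both conservation laws, since the two
  saturations sum to one at every level and so their increments are opposite.
\<close>

section \<open>Linear algebra: injective endomorphisms in finite dimension\<close>

text \<open>The functions vanishing off \<open>X\<close> form a space of dimension
  \<open>card X\<close>, on which an injective linear map is onto. All hypotheses look at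
  \<open>T\<close> and its arguments only on \<open>X\<close>, so that \<open>T\<close> may be
  arbitrary off the grid.\<close>

lemma injective_imp_solvable:
  fixes T :: "('a \<Rightarrow> real) \<Rightarrow> 'a \<Rightarrow> real"
  assumes fin: "finite X"
    and add: "\<And>u v x. x \<in> X \<Longrightarrow> T (\<lambda>y. u y + v y) x = T u x + T v x"
    and scale: "\<And>r u x. x \<in> X \<Longrightarrow> T (\<lambda>y. r * u y) x = r * T u x"
    and inj: "\<And>u x. \<forall>y\<in>X. T u y = 0 \<Longrightarrow> x \<in> X \<Longrightarrow> u x = 0"
  shows "\<exists>u. \<forall>x\<in>X. T u x = b x"
proof -
  \<comment> \<open>Scaling passed as an explicit parameter; the addition is the pointwise one of
    \<open>Function_Algebras\<close>.\<close>
  define sc :: "real \<Rightarrow> ('a \<Rightarrow> real) \<Rightarrow> 'a \<Rightarrow> real" where "sc = (\<lambda>r u y. r * u y)"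
  interpret V: vector_space sc
    by unfold_locales (auto simp: sc_def fun_eq_iff algebra_simps)
  \<comment> \<open>Cutting off outside \<open>X\<close> makes the map linear as a map of functions
    and sends everything into \<open>W\<close>, the space spanned by the indicators
    \<open>e x\<close> with \<open>x\<close> in \<open>X\<close>.\<close>
  define T' where "T' = (\<lambda>u x. if x \<in> X then T u x else 0)"
  interpret T': Vector_Spaces.linear sc sc T'
    by unfold_locales (auto simp: T'_def sc_def fun_eq_iff plus_fun_def add scale)
  define e :: "'a \<Rightarrow> 'a \<Rightarrow> real" where "e = (\<lambda>x y. of_bool (y = x))"
  define W :: "('a \<Rightarrow> real) set" where "W = {u. \<forall>x. x \<notin> X \<longrightarrow> u x = 0}"
  have sum_apply: "(\<Sum>i\<in>A. f i) y = (\<Sum>i\<in>A. f i y)" for f :: "'a \<Rightarrow> 'a \<Rightarrow> real" and A y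
    by (induction A rule: infinite_finite_induct) auto
  have W_sub: "V.subspace W"
    unfolding V.subspace_def by (auto simp: W_def sc_def)
  have inj_e: "inj_on e X"
    by (rule inj_onI) (metis e_def of_bool_eq(1,2) zero_neq_one)
  have expand: "w = (\<Sum>x\<in>X. sc (w x) (e x))" if "w \<in> W" for w
  proof
    fix y
    have "(\<Sum>x\<in>X. sc (w x) (e x)) y = (\<Sum>x\<in>X. if x = y then w x else 0)"
      unfolding sum_apply by (intro sum.cong) (auto simp: sc_def e_def)
    then show "w y = (\<Sum>x\<in>X. sc (w x) (e x)) y"
      using that fin by (auto simp: W_def)
  qed
  have "W \<subseteq> V.span (e ` X)"
  proof
    fix w assume "w \<in> W"
    show "w \<in> V.span (e ` X)"
      by (subst expand[OF \<open>w \<in> W\<close>])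
         (intro V.span_sum V.span_scale V.span_base imageI)
  qed
  moreover have "V.span (e ` X) \<subseteq> W"
    by (intro V.span_minimal W_sub) (auto simp: e_def W_def)
  ultimately have span_e: "V.span (e ` X) = W" by blast
  have ind_e: "V.independent (e ` X)"
  proof (subst V.independent_explicit_finite_subsets, intro allI impI ballI)
    fix A and g :: "('a \<Rightarrow> real) \<Rightarrow> real" and v
    assume A: "A \<subseteq> e ` X" and fA: "finite A" and s: "(\<Sum>v\<in>A. sc (g v) v) = 0" and v: "v \<in> A"
    obtain B where B: "B \<subseteq> X" "A = e ` B" using A by (metis subset_image_iff)
    then obtain z where z: "z \<in> B" "v = e z" using v by auto
    have fB: "finite B" using fin B finite_subset by blast
    have "(\<Sum>v\<in>A. sc (g v) v) = (\<Sum>x\<in>B. sc (g (e x)) (e x))"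
      unfolding B(2) by (subst sum.reindex) (auto intro: inj_on_subset[OF inj_e B(1)])
    \<comment> \<open>Evaluation at \<open>z\<close> isolates the coefficient of
      \<open>e z\<close>.\<close>
    then have "0 = (\<Sum>x\<in>B. sc (g (e x)) (e x)) z" using s by simp
    also have "\<dots> = (\<Sum>x\<in>B. if x = z then g (e x) else 0)"
      unfolding sum_apply by (intro sum.cong) (auto simp: sc_def e_def)
    also have "\<dots> = g v" using z fB by simp
    finally show "g v = 0" by simp
  qed
  have inj_T': "inj_on T' W"
  proof (subst T'.inj_on_iff_eq_0[OF W_sub], intro ballI impI)
    fix u assume u: "u \<in> W" "T' u = 0"
    have "\<forall>y\<in>X. T u y = 0"
      using fun_cong[OF u(2)] by (simp add: T'_def split: if_splits) metis
    then show "u = 0" using inj u(1) by (auto simp: W_def fun_eq_iff)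
  qed
  have ind_im: "V.independent (T' ` e ` X)"
    by (rule T'.independent_injective_image[OF ind_e]) (simp add: span_e inj_T')
  have eW: "e ` X \<subseteq> W" using span_e V.span_superset by blast
  have card_im: "card (T' ` e ` X) = card (e ` X)"
    by (rule card_image) (rule inj_on_subset[OF inj_T' eW])
  have T'W: "T' u \<in> W" for u by (simp add: T'_def W_def)
  define w where "w = (\<lambda>x. if x \<in> X then b x else 0)"
  have wW: "w \<in> W" by (simp add: w_def W_def)
  \<comment> \<open>Otherwise \<open>w\<close> together with the images of the basis would be
    \<open>card X + 1\<close> independent vectors in the span of \<open>card X\<close>
    vectors.\<close>
  have "w \<in> V.span (T' ` e ` X)"
  proof (rule ccontr)
    assume nin: "w \<notin> V.span (T' ` e ` X)"
    then have "V.independent (insert w (T' ` e ` X))"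
      using ind_im by (simp add: V.independent_insert)
    then have "card (insert w (T' ` e ` X)) \<le> card (e ` X)"
      using V.independent_span_bound[of "e ` X" "insert w (T' ` e ` X)"] fin wW T'W span_e
      by auto
    moreover have "w \<notin> T' ` e ` X" using nin V.span_base[of w "T' ` e ` X"] by (rule contrapos_nn)
    ultimately show False using fin card_im by simp
  qed
  then obtain u where "w = T' u"
    unfolding T'.span_image by (rule imageE)
  then have "\<forall>x\<in>X. T u x = b x"
    by (metis (no_types) T'_def w_def)
  then show ?thesis by blast
qed

context two_phase_grid
begin

section \<open>Geometry of the grid\<close>

lemma finite_cells: "finite cells"
proof -
  have "cells = PiE UNIV (\<lambda>i. {..<n i})"
    by (auto simp: cells_def PiE_def)
  then show ?thesis by (simp add: finite_PiE)
qed

lemma card_cells_pos: "card cells > 0"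
proof -
  have "(\<lambda>_. 0) \<in> cells" using n_pos by (simp add: cells_def)
  then show ?thesis using finite_cells card_gt_0_iff by blast
qed

lemma \<C>\<^sub>0_iff: "u \<in> \<C>\<^sub>0 \<longleftrightarrow> u \<in> extensional cells \<and> (\<Sum>c\<in>cells. u c) = 0"
  using card_cells_pos by (auto simp: \<C>\<^sub>0_def)

lemma \<phi>_pos: "c \<in> cells \<Longrightarrow> \<phi> c > 0"
  using porosity by (simp add: cells_def)

lemma lower_cells: "c \<in> cells \<Longrightarrow> lower i c \<in> cells"
  unfolding cells_def lower_def using less_imp_diff_less by fastforce

lemma upper_cells: "c \<in> cells \<Longrightarrow> Suc (c i) < n i \<Longrightarrow> upper i c \<in> cells"
  by (simp add: cells_def upper_def)

lemma lower_upper [simp]: "lower i (upper i c) = c"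
  by (simp add: lower_def upper_def)

text \<open>Subtraction on naturals truncates: if \<open>c i = 0\<close>, then
  \<open>lower i c\<close> is \<open>c\<close> itself.\<close>

lemma upper_lower: "0 < c i \<Longrightarrow> upper i (lower i c) = c"
  by (simp add: lower_def upper_def)

section \<open>Linearity, locality and telescoping of discrete fluxes\<close>

lemma flux_add: "flux M (\<lambda>c. u c + v c) i c = flux M u i c + flux M v i c"
  by (simp add: flux_def grad_def field_simps add_divide_distrib[symmetric])

lemma flux_scale: "flux M (\<lambda>c. r * u c) i c = r * flux M u i c"
  by (simp add: flux_def grad_def field_simps)

lemma div_flux_add:
  "div_h (flux M (\<lambda>c. u c + v c)) c = div_h (flux M u) c + div_h (flux M v) c"
  unfolding div_h_def flux_add sum.distrib[symmetric]
  by (intro sum.cong) (auto simp: diff_divide_distrib add_divide_distrib)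

lemma div_flux_scale: "div_h (flux M (\<lambda>c. r * u c)) c = r * div_h (flux M u) c"
  unfolding div_h_def flux_scale sum_distrib_left
  by (intro sum.cong) (auto simp: right_diff_distrib)

lemma flux_cong:
  assumes "\<And>c. c \<in> cells \<Longrightarrow> u c = v c" "c \<in> cells"
  shows "flux M u i c = flux M v i c"
  using assms lower_cells by (simp add: flux_def grad_def)

text \<open>The upper face of a cell is either interior, with both neighbours in the grid, or on the
  boundary, where the flux is zero. Hence values off the grid never enter, and a function may be
  exchanged for its restriction to \<open>cells\<close>.\<close>

lemma div_flux_cong:
  assumes "\<And>c. c \<in> cells \<Longrightarrow> u c = v c" and c: "c \<in> cells"
  shows "div_h (flux M u) c = div_h (flux M v) c"
proof -
  have "flux M u i (upper i c) = flux M v i (upper i c)" for i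
  proof (cases "Suc (c i) < n i")
    case True
    then show ?thesis using flux_cong assms(1) upper_cells[OF c] by blast
  next
    case False
    then show ?thesis by (simp add: flux_def upper_def)
  qed
  then show ?thesis
    unfolding div_h_def using flux_cong[OF assms] by simp
qed

lemma sum_div_flux: "(\<Sum>c\<in>cells. div_h (flux M u) c) = 0"
proof -
  have "(\<Sum>c\<in>cells. flux M u i (upper i c)) = (\<Sum>c\<in>cells. flux M u i c)" for i
  proof -
    \<comment> \<open>Boundary faces contribute zero. Each interior face is the upper face of
      exactly one cell and the lower face of exactly one cell, and \<open>upper i\<close> matches
      the two.\<close>
    have "(\<Sum>c\<in>cells. flux M u i (upper i c))
        = (\<Sum>c\<in>{c\<in>cells. Suc (c i) < n i}. flux M u i (upper i c))"
      by (rule sum.mono_neutral_right) (auto simp: finite_cells flux_def upper_def)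
    also have "\<dots> = (\<Sum>c\<in>{c\<in>cells. 0 < c i}. flux M u i c)"
      by (rule sum.reindex_bij_witness[of _ "lower i" "upper i"])
         (auto simp: lower_cells upper_cells upper_lower, auto simp: upper_def lower_def cells_def)
    also have "\<dots> = (\<Sum>c\<in>cells. flux M u i c)"
      by (rule sum.mono_neutral_left) (auto simp: finite_cells flux_def)
    finally show ?thesis .
  qed
  then show ?thesis
    unfolding div_h_def
    by (subst sum.swap) (simp add: sum_divide_distrib[symmetric] sum_subtractf)
qed

section \<open>Solvability of the discrete Neumann problem\<close>

text \<open>The Neumann problem in divergence form, before division by the porosity:
  \<open>f\<close> stands for \<phi> times an argument of \<open>\<L>_inv\<close>, and its zero sum
  is what \<open>compatible\<close> provides.\<close>

lemma mean_zero_flux_problem_solvable: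
  assumes inv: "invertible M" and f: "(\<Sum>c\<in>cells. f c) = 0"
  shows "\<exists>u\<in>\<C>\<^sub>0. \<forall>c\<in>cells. - div_h (flux M u) c = f c"
proof -
  define T where "T = (\<lambda>u c. - div_h (flux M u) c + (\<Sum>d\<in>cells. u d))"
  have sum_T: "(\<Sum>c\<in>cells. T u c) = real (card cells) * (\<Sum>d\<in>cells. u d)" for u
    by (simp add: T_def sum_subtractf sum_negf sum.distrib sum_div_flux)
  have mean: "(\<Sum>d\<in>cells. u d) = 0" if "(\<Sum>c\<in>cells. T u c) = 0" for u
    using that card_cells_pos unfolding sum_T by simp
  \<comment> \<open>If \<open>T u\<close> vanishes on the grid, then so does the sum of
    \<open>u\<close>, hence also the divergence alone. The restriction of \<open>u\<close> and the
    zero function are then mean-zero functions with the same image under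
    \<open>\<L> M\<close>.\<close>
  have zero: "u c = 0" if T0: "\<forall>d\<in>cells. T u d = 0" and c: "c \<in> cells" for u c
  proof -
    have m: "(\<Sum>d\<in>cells. u d) = 0" using mean T0 by simp
    have "restrict u cells \<in> \<C>\<^sub>0" "(\<lambda>c\<in>cells. 0) \<in> \<C>\<^sub>0"
      using m by (auto simp: \<C>\<^sub>0_iff)
    moreover have "\<L> M (restrict u cells) = \<L> M (\<lambda>c\<in>cells. 0)"
    proof -
      have "div_h (flux M (restrict u cells)) d = div_h (flux M (\<lambda>c\<in>cells. 0)) d"
        if d: "d \<in> cells" for d
      proof -
        have "div_h (flux M (restrict u cells)) d = div_h (flux M u) d"
          using d by (intro div_flux_cong) auto
        also have "\<dots> = 0" using T0 m d by (simp add: T_def)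
        also have "0 = div_h (flux M (\<lambda>c. 0 * u c)) d" by (subst div_flux_scale) simp
        also have "\<dots> = div_h (flux M (\<lambda>c\<in>cells. 0)) d"
          using d by (intro div_flux_cong) auto
        finally show ?thesis .
      qed
      then show ?thesis by (auto simp: \<L>_def intro!: restrict_ext)
    qed
    ultimately have "restrict u cells = (\<lambda>c\<in>cells. 0)"
      using inv unfolding invertible_def by (meson inj_onD)
    then show ?thesis using c by (metis restrict_apply')
  qed
  have "\<exists>u. \<forall>c\<in>cells. T u c = f c"
  proof (rule injective_imp_solvable[OF finite_cells])
    fix u v :: "'d cell_fun" and r c
    show "T (\<lambda>c. u c + v c) c = T u c + T v c"
      by (simp add: T_def div_flux_add sum.distrib)
    show "T (\<lambda>c. r * u c) c = r * T u c"
      by (simp add: T_def div_flux_scale sum_distrib_left[symmetric] right_diff_distrib)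
  qed (rule zero)
  then obtain u where u: "\<forall>c\<in>cells. T u c = f c" by blast
  \<comment> \<open>The zero sum of \<open>f\<close> forces \<open>u\<close> to have zero sum, so
    the augmenting term in \<open>T u\<close> disappears.\<close>
  have m: "(\<Sum>d\<in>cells. u d) = 0" using mean u f by simp
  have "restrict u cells \<in> \<C>\<^sub>0" using m by (simp add: \<C>\<^sub>0_iff)
  moreover have "- div_h (flux M (restrict u cells)) c = f c" if "c \<in> cells" for c
  proof -
    have "div_h (flux M (restrict u cells)) c = div_h (flux M u) c"
      using that by (intro div_flux_cong) auto
    then show ?thesis using u m that by (auto simp: T_def)
  qed
  ultimately show ?thesis by blast
qed

text \<open>\<open>the_inv_into\<close> is a right inverse only on the range of
  \<open>\<L> M\<close>. Compatibility provides a preimage of \<open>f\<close> on the grid, and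
  extensionality makes the image equal to \<open>f\<close> as a function.\<close>

lemma div_flux_\<L>_inv:
  assumes inv: "invertible M" and comp: "compatible f" and ext: "f \<in> extensional cells"
    and c: "c \<in> cells"
  shows "div_h (flux M (\<L>_inv M f)) c = - (\<phi> c * f c)"
proof -
  have "(\<Sum>c\<in>cells. \<phi> c * f c) = 0"
    using comp by (simp add: compatible_def \<C>\<^sub>0_iff)
  then obtain u where u: "u \<in> \<C>\<^sub>0" "\<forall>c\<in>cells. - div_h (flux M u) c = \<phi> c * f c"
    using mean_zero_flux_problem_solvable[OF inv] by blast
  have "\<L> M u = f"
  proof (rule extensionalityI[of _ cells])
    fix d assume d: "d \<in> cells"
    show "\<L> M u d = f d"
      using bspec[OF u(2) d] d \<phi>_pos[OF d] by (simp add: \<L>_def field_simps)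
  qed (use ext in \<open>simp_all add: \<L>_def\<close>)
  then have "\<L> M (\<L>_inv M f) = f"
    using u(1) inv unfolding \<L>_inv_def invertible_def by (metis f_the_inv_into_f imageI)
  from fun_cong[OF this, of c] show ?thesis
    using c \<phi>_pos[OF c] by (simp add: \<L>_def field_simps)
qed

section \<open>Conservation of mass\<close>

text \<open>The sign \<open>r\<close> serves both phases: it is -1 for the wetting phase, whose
  increment is \<open>\<delta>\<close>, and 1 for the non-wetting phase, whose increment is the
  negative of \<open>\<delta>\<close>. By linearity the divergence is
  \<open>- r / \<Delta>t * (\<phi> c * \<delta> c)\<close>, which is the storage term.\<close>

lemma conserves_massI:
  assumes inv: "invertible M" and comp: "compatible \<delta>" and ext: "\<delta> \<in> extensional cells"
    and q: "\<And>c. c \<in> cells \<Longrightarrow> q c = r / \<Delta>t * \<L>_inv M \<delta> c"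
    and S: "\<And>c. c \<in> cells \<Longrightarrow> S_new c - S_old c = - r * \<delta> c"
  shows "conserves_mass M S_old S_new q"
  unfolding conserves_mass_def
proof
  fix c assume c: "c \<in> cells"
  have "div_h (flux M q) c = div_h (flux M (\<lambda>c. r / \<Delta>t * \<L>_inv M \<delta> c)) c"
    by (rule div_flux_cong[OF q c])
  also have "\<dots> = r / \<Delta>t * (- (\<phi> c * \<delta> c))"
    by (simp only: div_flux_scale div_flux_\<L>_inv[OF inv comp ext c])
  finally show "\<phi> c * ((S_new c - S_old c) / \<Delta>t) - div_h (flux M q) c = 0"
    using S[OF c] by simp
qed

text \<open>Mobilities, potentials and pressure are arbitrary functions here, so one argument covers
  both schemes: \<open>p\<close> is instantiated with the pressure at the new level or at the half
  level.\<close>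

lemma step_conserves_mass:
  assumes inv: "invertible M\<^sub>w" "invertible M\<^sub>n" and comp: "compatible (increment S\<^sub>w k)"
    and step1: "\<And>c. c \<in> cells \<Longrightarrow> \<mu>\<^sub>w c - \<mu>\<^sub>n c + 1 / \<Delta>t * \<L>_inv M\<^sub>w (increment S\<^sub>w k) c
                  + 1 / \<Delta>t * \<L>_inv M\<^sub>n (increment S\<^sub>w k) c = 0"
    and step2: "\<And>c. c \<in> cells \<Longrightarrow> p c + \<mu>\<^sub>w c + 1 / \<Delta>t * \<L>_inv M\<^sub>w (increment S\<^sub>w k) c = 0"
    and old: "\<And>c. c \<in> cells \<Longrightarrow> S\<^sub>n k c = 1 - S\<^sub>w k c"
    and new: "\<And>c. c \<in> cells \<Longrightarrow> S\<^sub>n (k + 1) c = 1 - S\<^sub>w (k + 1) c"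
  shows "conserves_mass M\<^sub>w (S\<^sub>w k) (S\<^sub>w (k + 1)) (\<lambda>c. p c + \<mu>\<^sub>w c) \<and>
         conserves_mass M\<^sub>n (S\<^sub>n k) (S\<^sub>n (k + 1)) (\<lambda>c. p c + \<mu>\<^sub>n c)"
proof
  have ext: "increment S\<^sub>w k \<in> extensional cells" by (simp add: increment_def)
  show "conserves_mass M\<^sub>w (S\<^sub>w k) (S\<^sub>w (k + 1)) (\<lambda>c. p c + \<mu>\<^sub>w c)"
  proof (rule conserves_massI[OF inv(1) comp ext, of _ "-1"])
    fix c assume "c \<in> cells"
    from step2[OF this]
    show "p c + \<mu>\<^sub>w c = - 1 / \<Delta>t * \<L>_inv M\<^sub>w (increment S\<^sub>w k) c" by simp
  qed (simp add: increment_def)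
  show "conserves_mass M\<^sub>n (S\<^sub>n k) (S\<^sub>n (k + 1)) (\<lambda>c. p c + \<mu>\<^sub>n c)"
  proof (rule conserves_massI[OF inv(2) comp ext, of _ 1])
    fix c assume c: "c \<in> cells"
    from step1[OF c] step2[OF c]
    show "p c + \<mu>\<^sub>n c = 1 / \<Delta>t * \<L>_inv M\<^sub>n (increment S\<^sub>w k) c" by linarith
  qed (use old new in \<open>simp add: increment_def\<close>)
qed

lemma first_order_scheme_conservative:
  assumes scheme: "first_order_scheme N S\<^sub>w S\<^sub>n p" and k: "k < N"
  shows "first_order_conservative S\<^sub>w S\<^sub>n p k"
proof -
  have steps: "first_order_step S\<^sub>w S\<^sub>n p j" if "j < N" for j
    using scheme that by (simp add: first_order_scheme_def)
  \<comment> \<open>At level 0 this is the initial condition; at a later level it comes from step 2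
    of the preceding time step.\<close>
  have old: "S\<^sub>n k c = 1 - S\<^sub>w k c" if "c \<in> cells" for c
  proof (cases k)
    case 0
    then show ?thesis using scheme that by (simp add: first_order_scheme_def)
  next
    case (Suc j)
    then show ?thesis
      using steps[of j] k that by (simp add: first_order_step_def Let_def)
  qed
  show ?thesis
    unfolding first_order_conservative_def
    using steps[OF k] old unfolding first_order_step_def Let_def
    by (intro step_conserves_mass) auto
qed

lemma second_order_scheme_conservative:
  assumes scheme: "second_order_scheme N S\<^sub>w S\<^sub>n p" and k: "0 < k" "k < N"
  shows "second_order_conservative S\<^sub>w S\<^sub>n p k"
proof -
  have steps: "second_order_step S\<^sub>w S\<^sub>n p j" if "0 < j" "j < N" for j
    using scheme that by (simp add: second_order_scheme_def)
  \<comment> \<open>The scheme starts with \<open>k = 1\<close>, so level 1 is covered by the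
    starting data and only later levels by a preceding time step.\<close>
  have old: "S\<^sub>n k c = 1 - S\<^sub>w k c" if "c \<in> cells" for c
  proof (cases "k = 1")
    case True
    then show ?thesis using scheme that by (simp add: second_order_scheme_def)
  next
    case False
    then obtain j where "k = j + 1" "0 < j" using k by (cases k) auto
    then show ?thesis
      using steps[of j] k that by (simp add: second_order_step_def Let_def)
  qed
  show ?thesis
    unfolding second_order_conservative_def
    using steps[OF k] old unfolding second_order_step_def Let_def
    by (intro step_conserves_mass) auto
qed

end

theorem theorem4p1:
  fixes n :: "'d::finite \<Rightarrow> nat" and h :: real and \<phi> :: "'d cell_fun"
    and \<Delta>t m K \<eta>\<^sub>w \<eta>\<^sub>n \<sigma>\<^sub>w \<sigma>\<^sub>n \<sigma>\<^sub>w\<^sub>n :: real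
  assumes "two_phase_grid n h \<phi> \<Delta>t m K \<eta>\<^sub>w \<eta>\<^sub>n \<sigma>\<^sub>w \<sigma>\<^sub>n \<sigma>\<^sub>w\<^sub>n"
  shows "(\<forall>N S\<^sub>w S\<^sub>n p.
            two_phase_grid.first_order_scheme n h \<phi> \<Delta>t m K \<eta>\<^sub>w \<eta>\<^sub>n \<sigma>\<^sub>w \<sigma>\<^sub>n \<sigma>\<^sub>w\<^sub>n N S\<^sub>w S\<^sub>n p \<longrightarrow>
            (\<forall>k<N. two_phase_grid.first_order_conservative n h \<phi> \<Delta>t m K \<eta>\<^sub>w \<eta>\<^sub>n \<sigma>\<^sub>w \<sigma>\<^sub>n \<sigma>\<^sub>w\<^sub>n S\<^sub>w S\<^sub>n p k)) \<and>
         (\<forall>N S\<^sub>w S\<^sub>n p.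
            two_phase_grid.second_order_scheme n h \<phi> \<Delta>t m K \<eta>\<^sub>w \<eta>\<^sub>n \<sigma>\<^sub>w \<sigma>\<^sub>n \<sigma>\<^sub>w\<^sub>n N S\<^sub>w S\<^sub>n p \<longrightarrow>
            (\<forall>k. 0 < k \<and> k < N \<longrightarrow>
              two_phase_grid.second_order_conservative n h \<phi> \<Delta>t m K \<eta>\<^sub>w \<eta>\<^sub>n \<sigma>\<^sub>w \<sigma>\<^sub>n \<sigma>\<^sub>w\<^sub>n S\<^sub>w S\<^sub>n p k))"
  using two_phase_grid.first_order_scheme_conservative[OF assms]
    two_phase_grid.second_order_scheme_conservative[OF assms]
  by blast

end
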